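(* Let $n \ge 1$ and $d \ge 2$ be integers, and let $\mathcal{F} = \{(A_i^{(1)}, \dots, A_i^{(d)}) \mid i \in [m]\}$ be a Bollobás system of $d$-tuples with $A_i^{(p)} \subseteq [n]$ for all $i \in [m]$, $p \in [d]$. Then: (1) if $d = 3$, $$\sum_{i=1}^m \binom{|A_i^{(1)}| + |A_i^{(2)}| + |A_i^{(3)}|}{|A_i^{(1)}|, |A_i^{(2)}|, |A_i^{(3)}|}^{-1} \le \frac{n+3}{2};$$ (2) for every fixed $d$, as $n \to \infty$, $$\sum_{i=1}^m \binom{|A_i^{(1)}| + \cdots + |A_i^{(d)}|}{|A_i^{(1)}|, \dots, |A_i^{(d)}|}^{-1} \le \frac{1}{d-1}\binom{n+d-2}{d-2} + O(n^{d-3}),$$ i.e. there exist constants $C_d, N_d$ depending only on $d$ such that for all $n \ge N_d$ and every such Bollobás system with ground set $[n]$, the left-hand side is at most $\frac{1}{d-1}\binom{n+d-2}{d-2} + C_d n^{d-3}$.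
   Context: $[n] = \{1,\dots,n\}$. For nonnegative integers $a_1,\dots,a_d$, $\binom{a_1+\cdots+a_d}{a_1,\dots,a_d} = \frac{(a_1+\cdots+a_d)!}{a_1!\cdots a_d!}$ is the multinomial coefficient. A family $\mathcal{F} = \{(A_i^{(1)}, \dots, A_i^{(d)}) \mid i \in [m]\}$ of $d$-tuples of finite sets is a Bollobás system of $d$-tuples if $A_i^{(p)} \cap A_i^{(q)} = \emptyset$ for every $i \in [m]$ and $p \ne q$, and for any $i \ne j$ in $[m]$ there exist $p < q$ in $[d]$ with $A_i^{(p)} \cap A_j^{(q)} \ne \emptyset$. *)

theory Defs
  imports Complex_Main
begin

definition multinomial :: "nat \<Rightarrow> (nat \<Rightarrow> nat) \<Rightarrow> real" where
  "multinomial d a = fact (\<Sum>p=1..d. a p) / (\<Prod>p=1..d. fact (a p))"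

(* A i p is the p-th component of the i-th tuple. Only the values at i in {1..m} and
   p in {1..d} matter. The last condition ranges over ordered pairs (i, j), as
   swapping i and j changes it. *)
definition bollobas_system :: "nat \<Rightarrow> nat \<Rightarrow> (nat \<Rightarrow> nat \<Rightarrow> 'a set) \<Rightarrow> bool" where
  "bollobas_system d m A \<longleftrightarrow>
     (\<forall>i\<in>{1..m}. \<forall>p\<in>{1..d}. finite (A i p)) \<and>
     (\<forall>i\<in>{1..m}. \<forall>p\<in>{1..d}. \<forall>q\<in>{1..d}. p \<noteq> q \<longrightarrow> A i p \<inter> A i q = {}) \<and>
     (\<forall>i\<in>{1..m}. \<forall>j\<in>{1..m}. i \<noteq> j \<longrightarrow>
        (\<exists>p\<in>{1..d}. \<exists>q\<in>{1..d}. p < q \<and> A i p \<inter> A j q \<noteq> {}))"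

definition bollobas_system_on :: "nat \<Rightarrow> nat \<Rightarrow> nat \<Rightarrow> (nat \<Rightarrow> nat \<Rightarrow> nat set) \<Rightarrow> bool" where
  "bollobas_system_on n d m A \<longleftrightarrow>
     bollobas_system d m A \<and> (\<forall>i\<in>{1..m}. \<forall>p\<in>{1..d}. A i p \<subseteq> {1..n})"

end

theory Submission
  imports Defs "HOL-Combinatorics.Multiset_Permutations"
begin

text \<open>
  Order the ground set at random. A tuple is compatible with the order if all its elements in
  the \<open>p\<close>-th component precede those in the \<open>q\<close>-th for \<open>p < q\<close>; this has probability at least the
  inverse multinomial coefficient, so it suffices to bound the number of tuples that are
  compatible with a fixed order. Such a tuple is separated by \<open>k = d - 1\<close> cut points
  \<open>0 \<le> s\<^sub>1 \<le> \<dots> \<le> s\<^sub>k \<le> n\<close>, and the Bollobas condition makes these cut vectors an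
  antichain in the componentwise order.

  To bound the antichain, cover the integer vectors by chains: from a vector whose coordinate sum is
  divisible by \<open>k\<close>, increase the last coordinate by 1, then the one before it, and so on
  cyclically. Each chain covers \<open>k\<close> translation classes modulo the diagonal \<open>(1, \<dots>, 1)\<close>, distinct
  chains cover disjoint sets of classes, and an antichain meets each chain at most once.
\<close>

section \<open>Antichains of sorted integer vectors\<close>

lemma antichain_sorted_vectors:
  fixes s :: "'i \<Rightarrow> nat \<Rightarrow> nat" and k n :: nat
  assumes fin: "finite I" and k: "k \<ge> 1"
    and mono: "\<And>i p q. i \<in> I \<Longrightarrow> p \<le> q \<Longrightarrow> q < k \<Longrightarrow> s i p \<le> s i q"
    and bound: "\<And>i q. i \<in> I \<Longrightarrow> q < k \<Longrightarrow> s i q \<le> n"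
    and anti: "\<And>i j. i \<in> I \<Longrightarrow> j \<in> I \<Longrightarrow> i \<noteq> j \<Longrightarrow> \<exists>q<k. s j q < s i q"
  shows "k * card I \<le> (n + 2 * k - 1) choose (k - 1)"
proof -
  \<comment> \<open>\<open>b i\<close> is the vector with sum divisible by \<open>k\<close> at which the chain block of \<open>s i\<close> starts, \<open>T (i, j)\<close> is
    the vector \<open>j\<close> steps after \<open>b i\<close>, and the list \<open>e\<close> encodes \<open>T\<close> modulo the diagonal by its
    differences, which are at least -1 and sum up to at most \<open>n + 1\<close>.\<close>
  define r where "r i = (\<Sum>q<k. s i q) mod k" for i
  define b where "b i q = int (s i q) - of_bool (k - r i \<le> q)" for i q
  define T where "T x q = b (fst x) q + of_bool (k - snd x \<le> q)" for x :: "'i \<times> nat" and q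
  define e where "e x = nat (int n + 1 - (T x (k - 1) - T x 0)) #
      map (\<lambda>q. nat (T x (Suc q) - T x q + 1)) [0..<k - 1]" for x
  define L where "L = {l :: nat list. length l = k \<and> sum_list l = n + k}"
  have r_less: "r i < k" for i
    using k by (simp add: r_def)
  have sum_ind: "(\<Sum>q<k. of_bool (k - t \<le> q) :: int) = int t" if "t \<le> k" for t
  proof -
    have "{..<k} \<inter> {q. k - t \<le> q} = {k - t..<k}" by auto
    then have "card ({..<k} \<inter> {q. k - t \<le> q}) = t" using that by simp
    then show ?thesis by (simp add: Int_def)
  qed
  have sum_b: "(\<Sum>q<k. b i q) = int k * int ((\<Sum>q<k. s i q) div k)" for i
  proof -
    have "(\<Sum>q<k. b i q) = int (\<Sum>q<k. s i q) - int (r i)"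
      using r_less[of i] by (simp add: b_def sum_subtractf sum_ind del: sum_of_bool_eq)
    also have "\<dots> = int k * int ((\<Sum>q<k. s i q) div k)"
      unfolding r_def by (metis add_diff_cancel_right' mult_div_mod_eq of_nat_add of_nat_mult)
    finally show ?thesis .
  qed
  \<comment> \<open>Passing from \<open>s\<close> to \<open>b\<close> lowers a suffix by 1, so one
    difference may drop to -1, and \<open>T\<close> adds back a suffix. This is why \<open>e\<close>
    shifts the differences by 1; with \<open>width\<close> below it ensures that \<open>nat\<close>
    truncates nothing.\<close>
  have step: "T x (Suc q) - T x q + 1 \<ge> 0" if "fst x \<in> I" "Suc q < k" for x q
    using mono[OF that(1), of q "Suc q"] that(2) by (auto simp: T_def b_def of_bool_def)
  have width: "int n + 1 - (T x (k - 1) - T x 0) \<ge> 0" if "fst x \<in> I" for x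
    using bound[OF that, of "k - 1"] k by (auto simp: T_def b_def of_bool_def)
  have e_L: "e x \<in> L" if "x \<in> I \<times> {..<k}" for x
  proof -
    have x: "fst x \<in> I" using that by auto
    have "int (sum_list (map (\<lambda>q. nat (T x (Suc q) - T x q + 1)) [0..<k - 1]))
        = (\<Sum>q<k - 1. T x (Suc q) - T x q + 1)"
      using step[OF x] by (simp add: interv_sum_list_conv_sum_set_nat atLeast0LessThan)
    also have "\<dots> = T x (k - 1) - T x 0 + int (k - 1)"
      by (simp only: sum.distrib sum_lessThan_telescope) simp
    finally have "int (sum_list (e x)) = int (n + k)"
      using width[OF x] k by (simp add: e_def)
    then show ?thesis using k by (simp add: L_def e_def del: of_nat_add)
  qed
  have inj: "inj_on e (I \<times> {..<k})"
  proof (rule inj_onI)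
    fix x y assume x: "x \<in> I \<times> {..<k}" and y: "y \<in> I \<times> {..<k}" and exy: "e x = e y"
    have xI: "fst x \<in> I" "fst y \<in> I" using x y by auto
    define D where "D = T x 0 - T y 0"
    \<comment> \<open>Equal difference lists determine \<open>T\<close> up to the diagonal shift
      \<open>D\<close>.\<close>
    have diff: "T x q - T y q = D" if "q < k" for q
      using that
    proof (induction q)
      case (Suc q)
      have "nat (T x (Suc q) - T x q + 1) = nat (T y (Suc q) - T y q + 1)"
        using exy Suc.prems by (auto simp: e_def)
      then show ?case using step[OF xI(1) Suc.prems] step[OF xI(2) Suc.prems] Suc by auto
    qed (simp add: D_def)
    have sT: "(\<Sum>q<k. T x q) = int k * int ((\<Sum>q<k. s (fst x) q) div k) + int (snd x)"
      if "x \<in> I \<times> {..<k}" for x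
      using that by (auto simp: T_def sum.distrib sum_b sum_ind simp del: sum_of_bool_eq)
    have "(\<Sum>q<k. T x q) - (\<Sum>q<k. T y q) = (\<Sum>q<k. D)"
      using diff by (simp flip: sum_subtractf)
    then have eq: "int k * int ((\<Sum>q<k. s (fst x) q) div k) + int (snd x)
        = int k * (int ((\<Sum>q<k. s (fst y) q) div k) + D) + int (snd y)"
      using sT[OF x] sT[OF y] by (simp add: algebra_simps)
    \<comment> \<open>The sum of \<open>T x\<close> modulo \<open>k\<close> is invariant under diagonal translation and equals \<open>snd x\<close>.\<close>
    have "int (snd x) = int (snd y)"
      using arg_cong[OF eq, of "\<lambda>z. z mod int k"] x y by auto
    then have snd: "snd x = snd y" by simp
    then have bD: "b (fst x) q - b (fst y) q = D" if "q < k" for q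
      using diff[OF that] by (simp add: T_def)
    have le: "int (s i q) - 1 \<le> b i q" "b i q \<le> int (s i q)" for i q by (auto simp: b_def)
    \<comment> \<open>Two vectors with the same code are comparable. If \<open>D\<close> is nonzero,
      the shift outweighs the rounding error between \<open>s\<close> and \<open>b\<close>, which is
      at most 1. If \<open>D = 0\<close>, both arise from the same \<open>b\<close> by raising
      suffixes, and suffixes are nested.\<close>
    have "(\<forall>q<k. s (fst x) q \<le> s (fst y) q) \<or> (\<forall>q<k. s (fst y) q \<le> s (fst x) q)"
    proof -
      consider "D \<ge> 1" | "D \<le> - 1" | "D = 0" by linarith
      then show ?thesis
      proof cases
        case 1
        then have "s (fst y) q \<le> s (fst x) q" if "q < k" for q
          using bD[OF that] le[of "fst x" q] le[of "fst y" q] by linarith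
        then show ?thesis by blast
      next
        case 2
        then have "s (fst x) q \<le> s (fst y) q" if "q < k" for q
          using bD[OF that] le[of "fst x" q] le[of "fst y" q] by linarith
        then show ?thesis by blast
      next
        case 3
        have *: "int (s (fst x) q) - of_bool (k - r (fst x) \<le> q)
            = int (s (fst y) q) - of_bool (k - r (fst y) \<le> q)" if "q < k" for q
          using bD[OF that] 3 by (simp add: b_def)
        show ?thesis
        proof (cases "r (fst x) \<le> r (fst y)")
          case True
          have "s (fst x) q \<le> s (fst y) q" if "q < k" for q
            using *[OF that] True by (auto simp: of_bool_def split: if_splits)
          then show ?thesis by blast
        next
          case False
          have "s (fst y) q \<le> s (fst x) q" if "q < k" for q
            using *[OF that] False by (auto simp: of_bool_def split: if_splits)
          then show ?thesis by blast
        qed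
      qed
    qed
    then have "fst x = fst y"
      using anti[OF xI] anti[OF xI(2,1)] by (metis not_le)
    with snd show "x = y" by (simp add: prod_eq_iff)
  qed
  have card_L: "card L = (n + 2 * k - 1) choose (k - 1)"
  proof -
    have "card L = (n + k + k - 1) choose (n + k)"
      unfolding L_def by (rule card_length_sum_list)
    also have "\<dots> = (n + k + k - 1) choose (k - 1)"
      using k by (subst binomial_symmetric) auto
    finally show ?thesis by (simp add: mult_2 add.assoc)
  qed
  have "finite L"
  proof (rule finite_subset)
    show "L \<subseteq> {l. set l \<subseteq> {..n + k} \<and> length l = k}"
      by (auto simp: L_def dest: member_le_sum_list)
  qed (simp add: finite_lists_length_eq)
  then have "card (I \<times> {..<k}) \<le> card L"
    using inj e_L by (intro card_inj_on_le[of e]) auto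
  then show ?thesis by (simp add: card_L mult.commute card_cartesian_product)
qed

section \<open>Counting the orders compatible with a tuple\<close>

definition compatible :: "nat set \<Rightarrow> (nat \<Rightarrow> 'a set) \<Rightarrow> 'a list \<Rightarrow> bool" where
  "compatible D A xs \<longleftrightarrow> sorted_wrt (\<lambda>x y. \<forall>p\<in>D. \<forall>q\<in>D. x \<in> A p \<longrightarrow> y \<in> A q \<longrightarrow> p \<le> q) xs"

lemma compatible_nth:
  assumes "compatible D A xs" "a < b" "b < length xs" "p \<in> D" "q \<in> D" "xs ! a \<in> A p" "xs ! b \<in> A q"
  shows "p \<le> q"
  using sorted_wrt_nth_less[OF assms(1)[unfolded compatible_def] assms(2,3)] assms by blast

text \<open>Induction on the size of \<open>S\<close>, with \<open>A\<close> generalized since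
  deleting the first element of an order also deletes it from its component.\<close>

lemma card_compatible:
  fixes A :: "nat \<Rightarrow> 'a set"
  assumes "finite S" "finite D" "\<And>p. p \<in> D \<Longrightarrow> A p \<subseteq> S"
    and "\<And>p q. p \<in> D \<Longrightarrow> q \<in> D \<Longrightarrow> p \<noteq> q \<Longrightarrow> A p \<inter> A q = {}"
  shows "fact (card S) * (\<Prod>p\<in>D. fact (card (A p))) / fact (\<Sum>p\<in>D. card (A p))
         \<le> real (card {xs \<in> permutations_of_set S. compatible D A xs})"
  using assms
proof (induction "card S" arbitrary: S A)
  case 0
  then have "S = {}" by simp
  then have "A p = {}" if "p \<in> D" for p using 0 that by blast
  then show ?case using \<open>S = {}\<close> by (simp add: compatible_def)
next
  case (Suc N S A)
  \<comment> \<open>Condition on the first element of the order: it is harmless if it lies outside all \<open>A p\<close> or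
    in the first nonempty one.\<close>
  define U where "U = (\<Union>p\<in>D. A p)"
  define u where "u = (\<Sum>p\<in>D. card (A p))"
  define P where "P = (\<Prod>p\<in>D. fact (card (A p)) :: real)"
  define F where "F B X = {xs \<in> permutations_of_set X. compatible D B xs}" for B :: "nat \<Rightarrow> 'a set" and X
  have finA: "finite (A p)" if "p \<in> D" for p using Suc.prems that finite_subset by metis
  have US: "U \<subseteq> S" using Suc.prems by (auto simp: U_def)
  have cardU: "card U = u"
    unfolding U_def u_def using Suc.prems finA by (intro card_UN_disjoint) auto
  have finF: "finite (F B X)" for B X by (simp add: F_def)
  show ?case
  proof (cases "U = {}")
    case True
    then have e: "A p = {}" if "p \<in> D" for p using that by (auto simp: U_def)
    then have "compatible D A xs" for xs
      by (auto simp: compatible_def intro!: sorted_wrt01 simp: sorted_wrt_iff_nth_less)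
    then show ?thesis using e Suc.prems(1) by simp
  next
    case False
    define m where "m = Min {p \<in> D. A p \<noteq> {}}"
    have "m \<in> {p \<in> D. A p \<noteq> {}}"
      unfolding m_def using False Suc.prems(2) by (intro Min_in) (auto simp: U_def)
    then have m: "m \<in> D" "A m \<noteq> {}" by auto
    have m_le: "m \<le> p" if "p \<in> D" "x \<in> A p" for p x
      unfolding m_def using that Suc.prems(2) by (intro Min_le) auto
    have MU: "A m \<subseteq> U" using m by (auto simp: U_def)
    define G where "G x = (#) x ` F (\<lambda>p. A p - {x}) (S - {x})" for x
    have cardG: "card (G x) = card (F (\<lambda>p. A p - {x}) (S - {x}))" for x
      unfolding G_def by (intro card_image) auto
    have IH: "fact N * (\<Prod>p\<in>D. fact (card (A p - {x}))) / fact (\<Sum>p\<in>D. card (A p - {x}))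
        \<le> real (card (G x))" if "x \<in> S" for x
    proof -
      have N: "N = card (S - {x})" using that Suc.hyps(2) Suc.prems(1) by simp
      show ?thesis
        unfolding cardG F_def N
        by (rule Suc.hyps(1)[OF N]) (use Suc.prems in blast)+
    qed
    have sub: "(\<Union>x\<in>(S - U) \<union> A m. G x) \<subseteq> F A S"
    proof
      fix zs assume "zs \<in> (\<Union>x\<in>(S - U) \<union> A m. G x)"
      then obtain x ys where x: "x \<in> (S - U) \<union> A m" and zs: "zs = x # ys"
        and ys: "ys \<in> permutations_of_set (S - {x})" and r: "compatible D (\<lambda>p. A p - {x}) ys"
        by (auto simp: G_def F_def)
      have xS: "x \<in> S" using x MU US by auto
      have set_ys: "set ys = S - {x}" using ys by (simp add: permutations_of_set_def)
      have 1: "zs \<in> permutations_of_set S"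
        using ys xS by (auto simp: zs permutations_of_set_def)
      \<comment> \<open>A new first element in some component lies in \<open>A m\<close>, so
        disjointness gives \<open>p = m\<close>, and \<open>m\<close> is the least index of a
        nonempty component.\<close>
      have 2: "p \<le> q" if "p \<in> D" "q \<in> D" "x \<in> A p" "y \<in> A q" for p q y
      proof -
        have "x \<in> A m" using x that by (auto simp: U_def)
        then have "p = m" using Suc.prems(4)[of p m] that m by blast
        then show ?thesis using m_le that by blast
      qed
      have 3: "compatible D A ys"
        using r unfolding compatible_def
        by (rule sorted_wrt_mono_rel[rotated]) (use set_ys in auto)
      show "zs \<in> F A S" using 1 2 3 by (auto simp: F_def zs compatible_def)
    qed
    have finm: "finite (A m)" using finA m by blast
    have A_pos: "card (A m) \<ge> 1" using m finm by (simp add: Suc_le_eq card_gt_0_iff)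
    have u_pos: "u \<ge> 1" using A_pos m Suc.prems(2) unfolding u_def
      by (metis member_le_sum zero_le order_trans)
    have out: "fact N * P / fact u \<le> real (card (G x))" if "x \<in> S - U" for x
    proof -
      have "A p - {x} = A p" if "p \<in> D" for p using \<open>x \<in> S - U\<close> that by (auto simp: U_def)
      then show ?thesis using IH[of x] that by (simp add: P_def u_def)
    qed
    have inn: "fact N * (P / card (A m)) / fact (u - 1) \<le> real (card (G x))" if "x \<in> A m" for x
    proof -
      have o: "A p - {x} = A p" if "p \<in> D - {m}" for p
        using \<open>x \<in> A m\<close> that Suc.prems(4)[of p m] m by auto
      have c: "card (A m - {x}) = card (A m) - 1" using that by simp
      have "(\<Sum>p\<in>D. card (A p - {x})) = u - 1"
        unfolding u_def using m Suc.prems(2) o c A_pos by (simp add: sum.remove[of D m])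
      moreover have "(\<Prod>p\<in>D. fact (card (A p - {x}))) = P / card (A m)"
        unfolding P_def using m Suc.prems(2) o c A_pos
        by (simp add: prod.remove[of D m] fact_reduce[of "card (A m)"] field_simps)
      ultimately show ?thesis using IH[of x] that MU US by auto
    qed
    have sz: "card (S - U) = Suc N - u"
      using US Suc.prems(1) Suc.hyps(2) cardU by (metis card_Diff_subset finite_subset)
    have u_le: "u \<le> Suc N" using US Suc.prems(1) Suc.hyps(2) cardU by (metis card_mono)
    have fu: "fact u = real u * fact (u - 1)" using u_pos by (simp add: fact_reduce)
    \<comment> \<open>The factor \<open>card (A m)\<close> cancels and
      \<open>1 / fact (u - 1)\<close> is \<open>u / fact u\<close>, so the right side is
      \<open>(Suc N - u) + u\<close> copies of \<open>fact N * P / fact u\<close>.\<close>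
    have "fact (card S) * P / fact u
        = real (card (S - U)) * (fact N * P / fact u)
          + real (card (A m)) * (fact N * (P / card (A m)) / fact (u - 1))"
      using u_le u_pos A_pos unfolding sz Suc.hyps(2)[symmetric] fu
      by (simp add: field_simps of_nat_diff)
    also have "\<dots> \<le> (\<Sum>x\<in>S - U. real (card (G x))) + (\<Sum>x\<in>A m. real (card (G x)))"
      using sum_bounded_below[of "S - U" "fact N * P / fact u" "\<lambda>x. real (card (G x))", OF out]
        sum_bounded_below[of "A m" "fact N * (P / card (A m)) / fact (u - 1)" "\<lambda>x. real (card (G x))", OF inn]
      by linarith
    also have "\<dots> = (\<Sum>x\<in>(S - U) \<union> A m. real (card (G x)))"
      using Suc.prems(1) finm MU by (intro sum.union_disjoint[symmetric]) auto
    also have "\<dots> = real (card (\<Union>x\<in>(S - U) \<union> A m. G x))"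
      using Suc.prems(1) finm finF by (subst card_UN_disjoint) (auto simp: G_def)
    also have "\<dots> \<le> real (card (F A S))"
      using sub finF by (intro of_nat_mono card_mono)
    finally show ?thesis by (simp add: P_def u_def F_def)
  qed
qed

section \<open>From compatible tuples to cut vectors\<close>

text \<open>The length of the shortest prefix of \<open>xs\<close> containing all its elements from
  components 1 to \<open>Suc q\<close>; it is 0 if there are none. Indices start at 0, so a
  \<open>d\<close>-tuple has the cuts \<open>q < d - 1\<close>.\<close>

definition cut_point :: "(nat \<Rightarrow> 'a set) \<Rightarrow> 'a list \<Rightarrow> nat \<Rightarrow> nat" where
  "cut_point A xs q = (LEAST c. \<forall>a<length xs. \<forall>p\<in>{1..Suc q}. xs ! a \<in> A p \<longrightarrow> a < c)"

lemma cut_point_greater: "a < length xs \<Longrightarrow> p \<in> {1..Suc q} \<Longrightarrow> xs ! a \<in> A p \<Longrightarrow> a < cut_point A xs q"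
  unfolding cut_point_def by (rule LeastI2[of _ "length xs"]) auto

lemma cut_point_le: "(\<And>a p. a < length xs \<Longrightarrow> p \<in> {1..Suc q} \<Longrightarrow> xs ! a \<in> A p \<Longrightarrow> a < c) \<Longrightarrow> cut_point A xs q \<le> c"
  unfolding cut_point_def by (rule Least_le) auto

text \<open>Let \<open>x\<close> lie in \<open>A i p\<close> and \<open>A j q\<close> with
  \<open>p < q\<close>. The cut of \<open>i\<close> between components \<open>q - 1\<close> and
  \<open>q\<close> comes after \<open>x\<close>, while that of \<open>j\<close> comes before
  \<open>x\<close>. Hence the cut vectors form an antichain.\<close>

lemma card_compatible_tuples:
  assumes sys: "bollobas_system_on n d m A" and d: "d \<ge> 2"
    and xs: "xs \<in> permutations_of_set {1..n}"
  shows "(d - 1) * card {i \<in> {1..m}. compatible {1..d} (A i) xs} \<le> (n + 2 * (d - 1) - 1) choose (d - 1 - 1)"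
proof (rule antichain_sorted_vectors[where s = "\<lambda>i. cut_point (A i) xs"])
  have set_xs: "set xs = {1..n}" and len: "length xs = n"
    using xs by (auto simp: permutations_of_set_def dest: distinct_card)
  show "cut_point (A i) xs p \<le> cut_point (A i) xs q" if "p \<le> q" for i p q
    using that by (intro cut_point_le cut_point_greater) auto
  show "cut_point (A i) xs q \<le> n" for i q by (rule cut_point_le) (simp add: len)
  fix i j assume i: "i \<in> {i \<in> {1..m}. compatible {1..d} (A i) xs}"
    and j: "j \<in> {i \<in> {1..m}. compatible {1..d} (A i) xs}" and "i \<noteq> j"
  have "\<forall>i\<in>{1..m}. \<forall>j\<in>{1..m}. i \<noteq> j \<longrightarrow>
      (\<exists>p\<in>{1..d}. \<exists>q\<in>{1..d}. p < q \<and> A i p \<inter> A j q \<noteq> {})"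
    using sys unfolding bollobas_system_on_def bollobas_system_def by (elim conjE)
  with i j \<open>i \<noteq> j\<close> have "\<exists>p\<in>{1..d}. \<exists>q\<in>{1..d}. p < q \<and> A i p \<inter> A j q \<noteq> {}"
    by simp
  then obtain p q x where pq: "p \<in> {1..d}" "q \<in> {1..d}" "p < q" and x: "x \<in> A i p" "x \<in> A j q"
    by blast
  have "x \<in> set xs"
    using sys i pq x set_xs unfolding bollobas_system_on_def by blast
  then obtain a where a: "a < length xs" "xs ! a = x" by (auto simp: in_set_conv_nth)
  have disj: "A j p' \<inter> A j q = {}" if "p' \<in> {1..d}" "p' \<noteq> q" for p'
    using sys j pq that unfolding bollobas_system_on_def bollobas_system_def by blast
  \<comment> \<open>As \<open>q\<close> is at least 2, \<open>Suc (q - 2)\<close> is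
    \<open>q - 1\<close>: this cut closes exactly the components before \<open>q\<close>, and
    \<open>p\<close> is among them.\<close>
  have "cut_point (A j) xs (q - 2) \<le> a"
  proof (rule cut_point_le, rule ccontr)
    fix b p' assume b: "b < length xs" "p' \<in> {1..Suc (q - 2)}" "xs ! b \<in> A j p'" "\<not> b < a"
    then have p': "p' \<in> {1..d}" "p' < q" using pq by auto
    have "b \<noteq> a" using disj[OF p'(1)] p'(2) a x b by auto
    then have "q \<le> p'"
      by (intro compatible_nth[of "{1..d}" "A j" xs a b]) (use j a b x p' pq in auto)
    then show False using p' by simp
  qed
  also have "a < cut_point (A i) xs (q - 2)"
    by (rule cut_point_greater[of a xs p]) (use a x pq in auto)
  finally show "\<exists>q<d - 1. cut_point (A j) xs q < cut_point (A i) xs q"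
    using pq by (intro exI[of _ "q - 2"]) auto
qed (use d in auto)

section \<open>Averaging over all orders\<close>

text \<open>Double counting of pairs of a tuple and a compatible order: from below for each tuple,
  from above for each order, then division by \<open>fact n\<close>.\<close>

lemma bollobas_system_sum_le:
  assumes sys: "bollobas_system_on n d m A" and d: "d \<ge> 2"
  shows "(\<Sum>i=1..m. inverse (multinomial d (\<lambda>p. card (A i p))))
    \<le> real ((n + 2 * (d - 1) - 1) choose (d - 2)) / real (d - 1)"
proof -
  define X where "X = permutations_of_set {1..n}"
  define R where "R i xs \<longleftrightarrow> compatible {1..d} (A i) xs" for i xs
  define B where "B = (n + 2 * (d - 1) - 1) choose (d - 2)"
  have cardX: "card X = fact n" by (simp add: X_def)
  have finX: "finite X" by (simp add: X_def)
  have lower: "fact n * inverse (multinomial d (\<lambda>p. card (A i p))) \<le> (\<Sum>xs\<in>X. of_bool (R i xs))"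
    if "i \<in> {1..m}" for i
  proof -
    have "fact (card {1..n}) * (\<Prod>p\<in>{1..d}. fact (card (A i p))) / fact (\<Sum>p\<in>{1..d}. card (A i p))
       \<le> real (card {xs \<in> X. R i xs})"
      unfolding X_def R_def
      by (rule card_compatible)
        (use sys that in \<open>auto simp: bollobas_system_on_def bollobas_system_def\<close>)
    also have "real (card {xs \<in> X. R i xs}) = (\<Sum>xs\<in>X. of_bool (R i xs))"
      using finX by (simp add: Int_def)
    finally show ?thesis by (simp add: multinomial_def)
  qed
  have "fact n * (\<Sum>i=1..m. inverse (multinomial d (\<lambda>p. card (A i p))))
      \<le> (\<Sum>i=1..m. \<Sum>xs\<in>X. of_bool (R i xs))"
    unfolding sum_distrib_left by (rule sum_mono) (rule lower)
  also have "\<dots> = (\<Sum>xs\<in>X. \<Sum>i=1..m. of_bool (R i xs))"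
    by (rule sum.swap)
  also have "\<dots> = (\<Sum>xs\<in>X. real (card {i \<in> {1..m}. R i xs}))"
    by (simp add: Int_def)
  also have "\<dots> \<le> (\<Sum>xs\<in>X. real B / real (d - 1))"
  proof (rule sum_mono)
    fix xs assume "xs \<in> X"
    then have "(d - 1) * card {i \<in> {1..m}. R i xs} \<le> B"
      using card_compatible_tuples[OF sys d] by (simp add: X_def R_def B_def numeral_2_eq_2)
    then have "real (d - 1) * real (card {i \<in> {1..m}. R i xs}) \<le> real B"
      by (metis of_nat_le_iff of_nat_mult)
    then show "real (card {i \<in> {1..m}. R i xs}) \<le> real B / real (d - 1)"
      using d by (simp add: field_simps)
  qed
  also have "\<dots> = fact n * (real B / real (d - 1))"
    by (simp add: cardX)
  finally show ?thesis unfolding B_def by (rule mult_left_le_imp_le) simp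
qed

section \<open>Asymptotics of the binomial bound\<close>

text \<open>Pascal's rule, applied \<open>t\<close> times; each application adds a term that is at
  most \<open>(N + t) choose r\<close>.\<close>

lemma choose_shift_le: "(N + t) choose Suc r \<le> (N choose Suc r) + t * ((N + t) choose r)"
proof (induction t)
  case (Suc t)
  have "t * ((N + t) choose r) \<le> t * (Suc (N + t) choose r)"
    by (intro mult_left_mono binomial_right_mono) auto
  moreover have "(N + t) choose r \<le> Suc (N + t) choose r" by (rule binomial_right_mono) simp
  moreover have "(N + Suc t) choose Suc r = ((N + t) choose r) + ((N + t) choose Suc r)" by simp
  ultimately show ?case using Suc.IH unfolding mult_Suc add_Suc_right by linarith
qed simp

text \<open>Lowering the top by \<open>k\<close> costs \<open>k\<close> binomials of lower index
  \<open>k - 2\<close>, each of order \<open>n ^ (k - 2)\<close>. For \<open>k = 1\<close> both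
  binomials are 1 and the error term, a multiple of \<open>1 / n\<close>, is nonnegative.\<close>

lemma choose_asymptotic:
  assumes k: "k \<ge> 1" and n: "n \<ge> 1"
  shows "real ((n + 2 * k - 1) choose (k - 1))
    \<le> real ((n + k - 1) choose (k - 1)) + real (k * (2 * k + 1) ^ (k - 2)) * real n powi (int k - 2)"
proof (cases "k = 1")
  case False
  then obtain r where r: "k = Suc (Suc r)" using that[of "k - 2"] k by auto
  have "(n + 2 * k - 1) choose r \<le> (n + 2 * k - 1) ^ r"
    by (rule binomial_le_pow) (simp add: r)
  \<comment> \<open>Since \<open>n\<close> is at least 1, the summand \<open>2 * k\<close> is
    absorbed into \<open>2 * k * n\<close>.\<close>
  also have "\<dots> \<le> ((2 * k + 1) * n) ^ r"
  proof (rule power_mono)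
    have "2 * k * 1 \<le> 2 * k * n" using n by (rule mult_le_mono2)
    moreover have "(2 * k + 1) * n = 2 * k * n + n" by (simp add: algebra_simps)
    ultimately show "n + 2 * k - 1 \<le> (2 * k + 1) * n" by linarith
  qed simp
  finally have *: "(n + 2 * k - 1) choose r \<le> (2 * k + 1) ^ r * n ^ r"
    unfolding power_mult_distrib .
  have "(n + 2 * k - 1) choose (k - 1) \<le> ((n + k - 1) choose (k - 1)) + k * ((n + 2 * k - 1) choose r)"
  proof -
    have e: "n + k - 1 + k = n + 2 * k - 1" "Suc r = k - 1" using r by auto
    show ?thesis using choose_shift_le[of "n + k - 1" k r] unfolding e .
  qed
  also have "\<dots> \<le> ((n + k - 1) choose (k - 1)) + k * ((2 * k + 1) ^ r * n ^ r)"
    using * by (intro add_left_mono mult_left_mono) auto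
  finally have "real ((n + 2 * k - 1) choose (k - 1))
      \<le> real (((n + k - 1) choose (k - 1)) + k * ((2 * k + 1) ^ r * n ^ r))"
    by (simp only: of_nat_le_iff)
  moreover have "k - 2 = r" "int k - 2 = int r" using r by auto
  ultimately show ?thesis
    by (simp only: power_int_of_nat of_nat_add of_nat_mult of_nat_power mult.assoc)
qed simp

theorem theorem1p6:
  shows "(\<forall>(n::nat) (m::nat) (A :: nat \<Rightarrow> nat \<Rightarrow> nat set).
            n \<ge> 1 \<longrightarrow> bollobas_system_on n 3 m A \<longrightarrow>
            (\<Sum>i=1..m. inverse (multinomial 3 (\<lambda>p. card (A i p)))) \<le> (real n + 3) / 2)
       \<and> (\<forall>d::nat. d \<ge> 2 \<longrightarrow>
            (\<exists>(C::real) (N::nat). \<forall>(n::nat) (m::nat) (A :: nat \<Rightarrow> nat \<Rightarrow> nat set).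
               n \<ge> 1 \<longrightarrow> n \<ge> N \<longrightarrow> bollobas_system_on n d m A \<longrightarrow>
               (\<Sum>i=1..m. inverse (multinomial d (\<lambda>p. card (A i p))))
                 \<le> 1 / (real d - 1) * real ((n + d - 2) choose (d - 2))
                   + C * real n powi (int d - 3)))"
proof (intro conjI allI impI)
  fix n m :: nat and A :: "nat \<Rightarrow> nat \<Rightarrow> nat set"
  assume "bollobas_system_on n 3 m A"
  \<comment> \<open>For \<open>d = 3\<close> the general bound is
    \<open>((n + 3) choose 1) / 2\<close>.\<close>
  from bollobas_system_sum_le[OF this]
  show "(\<Sum>i=1..m. inverse (multinomial 3 (\<lambda>p. card (A i p)))) \<le> (real n + 3) / 2"
    by simp
next
  fix d :: nat assume d: "d \<ge> 2"
  define k where "k = d - 1"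
  \<comment> \<open>The error coefficient of \<open>choose_asymptotic\<close>, divided by
    \<open>k\<close> as in the averaged bound.\<close>
  define C where "C = real (k * (2 * k + 1) ^ (k - 2)) / real k"
  have k: "k \<ge> 1" "real d - 1 = real k" "d - 2 = k - 1" "int d - 3 = int k - 2"
    using d by (auto simp: k_def)
  have "(\<Sum>i=1..m. inverse (multinomial d (\<lambda>p. card (A i p))))
      \<le> 1 / (real d - 1) * real ((n + d - 2) choose (d - 2)) + C * real n powi (int d - 3)"
    if "n \<ge> 1" and sys: "bollobas_system_on n d m A" for n m A
  proof -
    have nd: "n + d - 2 = n + k - 1" using d by (simp add: k_def)
    have "(\<Sum>i=1..m. inverse (multinomial d (\<lambda>p. card (A i p))))
        \<le> real ((n + 2 * k - 1) choose (k - 1)) / real k"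
      using bollobas_system_sum_le[OF sys d] unfolding k_def[symmetric] k(3) .
    also have "\<dots> \<le> (real ((n + k - 1) choose (k - 1))
        + real (k * (2 * k + 1) ^ (k - 2)) * real n powi (int k - 2)) / real k"
      by (rule divide_right_mono[OF choose_asymptotic[OF k(1) that(1)]]) simp
    finally show ?thesis
      unfolding nd k(2,3,4) C_def by (simp only: add_divide_distrib times_divide_eq_left mult_1)
  qed
  then show "\<exists>(C::real) (N::nat). \<forall>(n::nat) (m::nat) (A :: nat \<Rightarrow> nat \<Rightarrow> nat set).
      n \<ge> 1 \<longrightarrow> n \<ge> N \<longrightarrow> bollobas_system_on n d m A \<longrightarrow>
      (\<Sum>i=1..m. inverse (multinomial d (\<lambda>p. card (A i p))))
        \<le> 1 / (real d - 1) * real ((n + d - 2) choose (d - 2)) + C * real n powi (int d - 3)"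
    by blast
qed

end
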